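(* Let $w\ge 4$, $u=w-2$, $v=w-1$, and let $\sum$ denote the sum over positive integers $a,c$ with $a+c=w-1$. Then, as identities of polynomials in $T$, \begin{align*} \sum \zeta_*(a,1,c)&=\zeta_*(1,1,u)+\zeta(v,1)+\zeta(2,u),\\ \sum \zeta_*(a,\bar1,\bar c)&=\zeta_*(1,\bar1,\bar u)+\zeta(\bar1,\bar u,\bar1)-\zeta(\bar1,\bar u,1)+\zeta(v,\bar1)+\zeta(\bar2,\bar u),\\ \sum \zeta(\bar a,\bar1,c)&=\zeta(\bar1,\bar1,\bar u)+\zeta(2,\bar u)+\zeta(\bar v,\bar1),\\ \sum \zeta(\bar a,1,\bar c)&=\zeta(\bar1,u,1)+\zeta(\bar1,1,u)-\zeta(\bar1,u,\bar1)+\zeta(\bar v,1)+\zeta(\bar2,u),\\ \sum \zeta(\bar a,1,c)&=\zeta(\bar1,\bar1,\bar u)+2\zeta(\bar v,1)+\zeta(\bar1,v)-\zeta(\bar1,\bar v)-\zeta(\bar v,\bar1)-\zeta(\bar u,2)-\zeta(w),\\ \sum \zeta_*(a,1,\bar c)&=\zeta(\bar u,\bar1,\bar1)-\zeta(\bar u,\bar1,1)+\zeta_*(1,1,\bar u)-\zeta(\bar v,\bar1)+\zeta(v,\bar1)+2\zeta(\bar v,\bar1)-\zeta(\bar v,1)\\ &\quad-\zeta(\bar u,\bar2)+\zeta(2)\zeta(\bar u)-\zeta(\bar w),\\ \sum \zeta_*(a,\bar1,c)&=2\zeta(u,\bar1,\bar1)-2\zeta(u,\bar1,1)+\zeta(\bar1,1,u)+\zeta_*(1,\bar1,u)-\zeta(\bar1,\bar1,u)+\zeta(\bar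 v,\bar1)+\zeta(v,\bar1)\\ &\quad+\zeta(\bar1,v)-\zeta(\bar v,1)-\zeta(\bar1,\bar v)-\zeta(2,u)-2\zeta(u,\bar2)-\zeta(\bar w)-\zeta(w),\\ \sum \zeta(\bar a,\bar1,\bar c)&=3\zeta(u,\bar1,1)-3\zeta(u,\bar1,\bar1)+\zeta(\bar1,\bar1,u)+2\zeta(\bar v,1)-\zeta(\bar v,\bar1)+\zeta(u,\bar2)+\zeta(2,u)-\zeta(u,2). \end{align*}
   Context: Euler sums: for positive integers $s_j$ and $z_j\in\{\pm1\}$, $\zeta(s_1,\dots,s_d;z_1,\dots,z_d)=\sum_{n_1>\dots>n_d>0}\frac{z_1^{n_1}\cdots z_d^{n_d}}{n_1^{s_1}\cdots n_d^{s_d}}$, convergent iff $(s_1,z_1)\ne(1,1)$; a bar over the $j$-th argument means $z_j=-1$, no bar means $z_j=1$. Stuffle regularization: the truncated sum $\zeta^{(M)}$ (restricted to $M\ge n_1$) has, as $M\to\infty$, an expansion $P(\log M+\gamma)+o(1)$ with $P$ a polynomial ($\gamma$ Euler's constant); $\zeta_*:=P(T)\in\mathbb{R}[T]$, which equals the Euler sum for convergent indices. *)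

theory Defs
  imports "HOL-Analysis.Analysis" "HOL-Computational_Algebra.Polynomial"
begin

text \<open>An index is a list of pairs (s_j, b_j); b_j = True means a bar, i.e. z_j = -1.\<close>

definition esign :: "bool \<Rightarrow> nat \<Rightarrow> real" where
  "esign b n = (if b then (-1) ^ n else 1)"

fun zeta_trunc :: "(nat \<times> bool) list \<Rightarrow> nat \<Rightarrow> real" where
  "zeta_trunc [] M = 1"
| "zeta_trunc ((s, b) # xs) M =
     (\<Sum>n = 1..M. esign b n / real n ^ s * zeta_trunc xs (n - 1))"

definition zeta :: "(nat \<times> bool) list \<Rightarrow> real" where
  "zeta xs = lim (\<lambda>M. zeta_trunc xs M)"

definition zeta_st :: "(nat \<times> bool) list \<Rightarrow> real poly" where
  "zeta_st xs = (THE P. ((\<lambda>M. zeta_trunc xs M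
       - poly P (ln (real M) + euler_mascheroni)) \<longlongrightarrow> 0) sequentially)"

end

theory Submission
  imports Defs "HOL-Real_Asymp.Real_Asymp"
begin

text \<open>
  Let \<open>u = w - 2\<close>. In a sum over \<open>a + c = w - 1\<close> the terms \<open>1 / (n\<^sup>a k\<^sup>c)\<close> form a geometric progression
  with sum \<open>(1 / k\<^sup>u - 1 / n\<^sup>u) / (n - k)\<close>. Hence every truncated left-hand side is a sum over a single
  variable \<open>n\<close> of \<open>1 / n\<^sup>u\<close> times a coefficient, and partial fractions turn the coefficient into a
  polynomial in alternating harmonic sums of depth at most two, up to an error that vanishes in the
  limit. The right-hand sides have the same shape. The coefficients of each identity agree by the
  stuffle product; in the fifth and seventh identity they agree up to a constant whose limit
  vanishes by the shuffle product \<open>\<zeta>(-1)\<^sup>2 = 2 \<zeta>(-1, 1)\<close> and by \<open>2 \<zeta>(-2) = - \<zeta>(2)\<close>, where a minus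
  sign stands for a bar. The only divergent sum on the left is the term \<open>a = 1\<close>, which also occurs
  on the right, so the regularization plays no further role.
\<close>

section \<open>Signs and alternating harmonic sums\<close>

declare zeta_trunc.simps(2) [simp del]

text \<open>Two bars cancel, so signs multiply by exclusive or. The second form is needed because
  the simplifier rewrites \<open>x \<noteq> y\<close> to \<open>x = (\<not> y)\<close>.\<close>

lemma esign_xor:
  "esign (x \<noteq> y) n = esign x n * esign y n" "esign (x = (\<not> y)) n = esign x n * esign y n"
  by (auto simp: esign_def simp flip: power_mult_distrib)

lemma esign_mult_self [simp]: "esign x n * esign x n = 1" "esign x n * (esign x n * a) = a"
  by (auto simp: esign_def simp flip: power_mult_distrib mult.assoc)

lemma esign_add: "esign x (m + n) = esign x m * esign x n"
  by (simp add: esign_def power_add)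

lemma esign_diff: "m \<le> n \<Longrightarrow> esign x (n - m) = esign x n * esign x m"
  using esign_add[of x "n - m" m] by (simp add: mult.assoc)

lemma abs_esign [simp]: "\<bar>esign x n\<bar> = 1"
  by (simp add: esign_def)

lemma zeta_trunc_0 [simp]: "zeta_trunc ((s, b) # xs) 0 = 0"
  by (simp add: zeta_trunc.simps)

lemma zeta_trunc_Suc:
  "zeta_trunc ((s, b) # xs) (Suc M) =
     zeta_trunc ((s, b) # xs) M + esign b (Suc M) / real (Suc M) ^ s * zeta_trunc xs M"
  by (simp add: zeta_trunc.simps)

definition hsum :: "bool \<Rightarrow> nat \<Rightarrow> real" where
  "hsum x n = zeta_trunc [(1, x)] n"

definition hsum2 :: "bool \<Rightarrow> bool \<Rightarrow> nat \<Rightarrow> real" where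
  "hsum2 x y n = zeta_trunc [(1, x), (1, y)] n"

definition qsum :: "bool \<Rightarrow> nat \<Rightarrow> real" where
  "qsum x n = zeta_trunc [(2, x)] n"

lemma hsum_0 [simp]: "hsum x 0 = 0" and hsum2_0 [simp]: "hsum2 x y 0 = 0"
  and qsum_0 [simp]: "qsum x 0 = 0"
  by (simp_all add: hsum_def hsum2_def qsum_def)

lemma hsum_Suc: "hsum x (Suc n) = hsum x n + esign x (Suc n) / real (Suc n)"
  and hsum2_Suc: "hsum2 x y (Suc n) = hsum2 x y n + esign x (Suc n) / real (Suc n) * hsum y n"
  and qsum_Suc: "qsum x (Suc n) = qsum x n + esign x (Suc n) / real (Suc n) ^ 2"
  by (simp_all add: hsum_def hsum2_def qsum_def zeta_trunc_Suc)

lemma hsum_eq: "hsum x n = (\<Sum>i=1..n. esign x i / real i)"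
  by (induction n) (simp_all add: hsum_Suc)

lemma hsum2_eq: "hsum2 x y n = (\<Sum>i=1..n. esign x i / real i * hsum y (i - 1))"
  by (induction n) (simp_all add: hsum2_Suc)

lemma qsum_eq: "qsum x n = (\<Sum>i=1..n. esign x i / real i ^ 2)"
  by (induction n) (simp_all add: qsum_Suc)

text \<open>Stuffle product: the pairs of indices with the first larger, the second larger or both
  equal give the three terms. On the diagonal the signs multiply.\<close>

lemma hsum_mult_hsum:
  "hsum x n * hsum y n = hsum2 x y n + hsum2 y x n + qsum (x \<noteq> y) n"
proof (induction n)
  case (Suc n)
  define r where "r = 1 / real (Suc n)"
  have r: "a / real (Suc n) = a * r" "a / real (Suc n) ^ 2 = a * r\<^sup>2" for a
    by (simp_all add: r_def power_divide)
  show ?case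
    unfolding hsum_Suc hsum2_Suc qsum_Suc esign_xor(1) r using Suc.IH
    by (simp only: algebra_simps power2_eq_square)
qed simp

lemma hsum_diff_eq: "j \<le> n \<Longrightarrow> hsum x n - hsum x j = (\<Sum>i=j+1..n. esign x i / real i)"
  unfolding hsum_eq by (induction n rule: dec_induct) auto

section \<open>Collapsing the sum over the exponents to one variable\<close>

lemma sum_triangle_swap:
  fixes f :: "nat \<Rightarrow> nat \<Rightarrow> real"
  shows "(\<Sum>n=1..M. \<Sum>m=1..n-1. f n m) = (\<Sum>m=1..M. \<Sum>n=m+1..M. f n m)"
proof (induction M)
  case (Suc M)
  have "(\<Sum>m=1..Suc M. \<Sum>n=m+1..Suc M. f n m) = (\<Sum>m=1..M. (\<Sum>n=m+1..M. f n m) + f (Suc M) m)"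
    by (auto intro!: sum.cong)
  then show ?case using Suc by (simp add: sum.distrib)
qed simp

lemma geometric_sum_mixed_powers:
  fixes x y :: real
  assumes "x > 0" "y > 0" "x \<noteq> y"
  shows "(\<Sum>a=1..u. 1 / (x ^ a * y ^ (u + 1 - a))) = (1 / y ^ u - 1 / x ^ u) / (x - y)"
proof (induction u)
  case (Suc u)
  have "(\<Sum>a=1..Suc u. 1 / (x ^ a * y ^ (Suc u + 1 - a)))
      = (\<Sum>a=1..u. 1 / (x ^ a * y ^ (u + 1 - a))) / y + 1 / (x ^ Suc u * y)"
    by (auto simp: sum_divide_distrib Suc_diff_le intro!: sum.cong)
  also have "\<dots> = (1 / y ^ Suc u - 1 / x ^ Suc u) / (x - y)"
    unfolding Suc.IH using assms by (simp add: divide_simps) (simp add: algebra_simps)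
  finally show ?case .
qed simp

text \<open>The geometric sum splits into a part with \<open>1 / k ^ u\<close> and one with
  \<open>1 / n ^ u\<close>, where \<open>n > m > k\<close>. This is the coefficient of the former
  and \<open>lower_conv\<close> that of the latter. Writing the sign at \<open>n - k\<close> leaves
  in both cases the common factor \<open>esign (x \<noteq> z)\<close> at the free variable.\<close>

definition upper_conv :: "bool \<Rightarrow> bool \<Rightarrow> nat \<Rightarrow> nat \<Rightarrow> real" where
  "upper_conv x y M k =
     (\<Sum>m=k+1..M. \<Sum>n=m+1..M. esign y m * esign x (n - k) / (real m * real (n - k)))"

definition lower_conv :: "bool \<Rightarrow> bool \<Rightarrow> nat \<Rightarrow> real" where
  "lower_conv y z n =
     (\<Sum>m=1..n-1. \<Sum>k=1..m-1. esign y m * esign z (n - k) / (real m * real (n - k)))"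

lemma sum_zeta_trunc_3:
  "(\<Sum>a=1..u. zeta_trunc [(a, x), (1, y), (u + 1 - a, z)] M)
     = (\<Sum>n=1..M. esign (x \<noteq> z) n / real n ^ u * (upper_conv x y M n - lower_conv y z n))"
proof -
  define c where "c n m k = esign x n * esign y m * esign z k / (real m * (real n - real k))" for n m k
  have "(\<Sum>a=1..u. zeta_trunc [(a, x), (1, y), (u + 1 - a, z)] M)
      = (\<Sum>a=1..u. \<Sum>n=1..M. \<Sum>m=1..n-1. \<Sum>k=1..m-1.
          esign x n * esign y m * esign z k / real m * (1 / (real n ^ a * real k ^ (u + 1 - a))))"
    by (simp add: zeta_trunc.simps sum_distrib_left sum_divide_distrib mult_ac)
  also have "\<dots> = (\<Sum>n=1..M. \<Sum>m=1..n-1. \<Sum>k=1..m-1. \<Sum>a=1..u.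
          esign x n * esign y m * esign z k / real m * (1 / (real n ^ a * real k ^ (u + 1 - a))))"
    by (subst sum.swap, rule sum.cong[OF refl], subst sum.swap, rule sum.cong[OF refl],
        subst sum.swap, rule refl)
  also have "\<dots> = (\<Sum>n=1..M. \<Sum>m=1..n-1. \<Sum>k=1..m-1. c n m k / real k ^ u - c n m k / real n ^ u)"
  proof (intro sum.cong refl)
    fix n m k assume "n \<in> {1..M}" "m \<in> {1..n-1}" "k \<in> {1..m-1}"
    then have "0 < k" "k < n" by auto
    then have "(\<Sum>a=1..u. 1 / (real n ^ a * real k ^ (u + 1 - a)))
        = (1 / real k ^ u - 1 / real n ^ u) / (real n - real k)"
      by (intro geometric_sum_mixed_powers) auto
    then show "(\<Sum>a=1..u. esign x n * esign y m * esign z k / real m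
          * (1 / (real n ^ a * real k ^ (u + 1 - a)))) = c n m k / real k ^ u - c n m k / real n ^ u"
      unfolding sum_distrib_left[symmetric] c_def
      by (simp add: diff_divide_distrib right_diff_distrib mult_ac)
  qed
  also have "\<dots> = (\<Sum>n=1..M. \<Sum>m=1..n-1. \<Sum>k=1..m-1. c n m k / real k ^ u)
      - (\<Sum>n=1..M. \<Sum>m=1..n-1. \<Sum>k=1..m-1. c n m k / real n ^ u)"
    by (simp add: sum_subtractf)
  \<comment> \<open>Two exchanges over triangles bring \<open>k\<close> from the innermost to the
    outermost place.\<close>
  also have "(\<Sum>n=1..M. \<Sum>m=1..n-1. \<Sum>k=1..m-1. c n m k / real k ^ u)
      = (\<Sum>m=1..M. \<Sum>k=1..m-1. \<Sum>n=m+1..M. c n m k / real k ^ u)"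
    unfolding sum_triangle_swap[of "\<lambda>n m. \<Sum>k=1..m-1. c n m k / real k ^ u"]
    by (intro sum.cong refl sum.swap)
  also have "\<dots> = (\<Sum>k=1..M. \<Sum>m=k+1..M. \<Sum>n=m+1..M. c n m k / real k ^ u)"
    by (rule sum_triangle_swap)
  also have "\<dots> = (\<Sum>k=1..M. esign (x \<noteq> z) k / real k ^ u * upper_conv x y M k)"
    unfolding upper_conv_def sum_distrib_left
  proof (intro sum.cong refl)
    fix k m n assume "k \<in> {1..M}" "m \<in> {k+1..M}" "n \<in> {m+1..M}"
    then show "c n m k / real k ^ u = esign (x \<noteq> z) k / real k ^ u
        * (esign y m * esign x (n - k) / (real m * real (n - k)))"
      by (simp add: c_def esign_xor esign_diff mult_ac)
  qed
  also have "(\<Sum>n=1..M. \<Sum>m=1..n-1. \<Sum>k=1..m-1. c n m k / real n ^ u)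
      = (\<Sum>n=1..M. esign (x \<noteq> z) n / real n ^ u * lower_conv y z n)"
    unfolding lower_conv_def sum_distrib_left
  proof (intro sum.cong refl)
    fix k m n assume "n \<in> {1..M}" "m \<in> {1..n-1}" "k \<in> {1..m-1}"
    then have "k \<le> n" by auto
    then show "c n m k / real n ^ u = esign (x \<noteq> z) n / real n ^ u
        * (esign y m * esign z (n - k) / (real m * real (n - k)))"
      by (simp add: c_def esign_xor esign_diff mult_ac)
  qed
  finally show ?thesis
    by (simp add: sum_subtractf right_diff_distrib)
qed

section \<open>Closed forms of the two coefficients\<close>

text \<open>Truncated shuffle product: the left side runs over \<open>b, i \<ge> 1\<close> with
  \<open>b + i \<le> n\<close>, and \<open>1 / (b * i) = (1 / b + 1 / i) / (b + i)\<close> makes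
  \<open>b + i\<close> the outer index of two nested sums.\<close>

lemma sum_hsum_convolution:
  "(\<Sum>b=1..n-1. esign y b / real b * hsum z (n - b)) = hsum2 z (y \<noteq> z) n + hsum2 y (y \<noteq> z) n"
proof (induction n)
  case (Suc n)
  have "(\<Sum>b=1..n. esign y b / real b * hsum z (Suc n - b))
      = (\<Sum>b=1..n. esign y b / real b * hsum z (n - b))
        + (\<Sum>b=1..n. esign y b / real b * (esign z (Suc n - b) / real (Suc n - b)))"
    unfolding sum.distrib[symmetric]
    by (intro sum.cong refl) (auto simp: Suc_diff_le hsum_Suc algebra_simps)
  \<comment> \<open>The term \<open>b = n\<close> vanishes since
    \<open>hsum z 0 = 0\<close>.\<close>
  also have "(\<Sum>b=1..n. esign y b / real b * hsum z (n - b))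
      = (\<Sum>b=1..n-1. esign y b / real b * hsum z (n - b))"
    by (cases n) auto
  also have "(\<Sum>b=1..n. esign y b / real b * (esign z (Suc n - b) / real (Suc n - b)))
      = (\<Sum>b=1..n. esign z (Suc n) / real (Suc n) * (esign (y \<noteq> z) b / real b)
          + esign y (Suc n) / real (Suc n) * (esign (y \<noteq> z) (Suc n - b) / real (Suc n - b)))"
  proof (intro sum.cong refl)
    fix b assume "b \<in> {1..n}"
    then have b: "0 < b" "b < Suc n" by auto
    have "real (Suc n - b) = real (Suc n) - real b" using b by simp
    moreover have "esign y (Suc n) * esign (y \<noteq> z) (Suc n - b) = esign y b * esign z (Suc n - b)"
      "esign z (Suc n) * esign (y \<noteq> z) b = esign y b * esign z (Suc n - b)"
      using b by (auto simp: esign_xor esign_diff mult_ac)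
    moreover have "s / real b * (t / (real (Suc n) - real b))
        = 1 / real (Suc n) * (s * t / real b) + 1 / real (Suc n) * (s * t / (real (Suc n) - real b))" for s t
      using b by (simp add: divide_simps del: of_nat_Suc) (simp add: algebra_simps)
    ultimately show "esign y b / real b * (esign z (Suc n - b) / real (Suc n - b))
      = esign z (Suc n) / real (Suc n) * (esign (y \<noteq> z) b / real b)
          + esign y (Suc n) / real (Suc n) * (esign (y \<noteq> z) (Suc n - b) / real (Suc n - b))"
      by simp
  qed
  also have "\<dots> = esign z (Suc n) / real (Suc n) * hsum (y \<noteq> z) n
      + esign y (Suc n) / real (Suc n) * (\<Sum>b=1..n. esign (y \<noteq> z) (Suc n - b) / real (Suc n - b))"
    by (simp add: sum.distrib hsum_eq sum_distrib_left)
  also have "(\<Sum>b=1..n. esign (y \<noteq> z) (Suc n - b) / real (Suc n - b)) = hsum (y \<noteq> z) n"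
    unfolding hsum_eq by (subst sum.atLeastAtMost_rev) simp
  finally show ?case
    using Suc.IH by (simp add: hsum2_Suc)
qed simp

text \<open>For fixed \<open>m\<close> the differences \<open>n - k\<close> fill the interval from
  \<open>n - m + 1\<close> to \<open>n - 1\<close>. The sum over \<open>k\<close> is thus a
  difference of two harmonic sums, and the sum over \<open>m\<close> then yields a product and a
  convolution.\<close>

lemma lower_conv_eq:
  "lower_conv y z n = hsum z (n - 1) * hsum y (n - 1) - hsum2 z (y \<noteq> z) n - hsum2 y (y \<noteq> z) n"
proof -
  have "(\<Sum>k=1..m-1. esign y m * esign z (n - k) / (real m * real (n - k)))
      = esign y m / real m * (hsum z (n - 1) - hsum z (n - m))" if m: "m \<in> {1..n-1}" for m
  proof -
    have "(\<Sum>k=1..m-1. esign z (n - k) / real (n - k)) = (\<Sum>i=n-m+1..n-1. esign z i / real i)"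
      by (rule sum.reindex_bij_witness[of _ "\<lambda>i. n - i" "\<lambda>i. n - i"]) (use m in auto)
    also have "\<dots> = hsum z (n - 1) - hsum z (n - m)"
      using m by (subst hsum_diff_eq) auto
    finally show ?thesis
      by (simp only: times_divide_times_eq[symmetric] sum_distrib_left[symmetric])
  qed
  then have "lower_conv y z n
      = (\<Sum>m=1..n-1. esign y m / real m * hsum z (n - 1) - esign y m / real m * hsum z (n - m))"
    unfolding lower_conv_def by (intro sum.cong refl) (simp add: right_diff_distrib)
  also have "\<dots> = hsum z (n - 1) * hsum y (n - 1)
      - (\<Sum>m=1..n-1. esign y m / real m * hsum z (n - m))"
    unfolding sum_subtractf hsum_eq[of y] sum_distrib_left by (simp add: mult.commute)
  finally show ?thesis
    unfolding sum_hsum_convolution by simp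
qed

text \<open>Induction on the shift \<open>n\<close>: raising it by one removes the term
  \<open>1 / (b - n)\<close> from the inner sum, and
  \<open>1 / (b * (b - n)) = (1 / (b - n) - 1 / b) / n\<close> turns the loss into harmonic sums.
  Shift 1 is the nested sum itself.\<close>

lemma sum_hsum_correlation:
  assumes "1 \<le> n" "n \<le> M"
  shows "(\<Sum>b=n+1..M. esign y b / real b * hsum x (b - n)) = hsum2 y x M
    - (\<Sum>j=1..n-1. (esign y j * hsum (x \<noteq> y) (M - j)
          - esign x j * (hsum (x \<noteq> y) M - hsum (x \<noteq> y) j)) / real j)"
  using assms
proof (induction n rule: dec_induct)
  case base
  have "(\<Sum>b=1..M. esign y b / real b * hsum x (b - 1))
      = (\<Sum>b=1+1..M. esign y b / real b * hsum x (b - 1))"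
    by (rule sum.mono_neutral_right) (auto simp: not_le le_Suc_eq)
  then show ?case by (simp add: hsum2_eq)
next
  case (step n)
  then have n: "0 < n" "Suc n \<le> M" by auto
  have "(\<Sum>b=n+1..M. esign y b / real b * hsum x (b - n))
      = (\<Sum>b=n+1..M. esign y b / real b * hsum x (b - Suc n))
      + (\<Sum>b=n+1..M. esign y b / real b * (esign x (b - n) / real (b - n)))"
    unfolding sum.distrib[symmetric]
  proof (intro sum.cong refl)
    fix b assume "b \<in> {n+1..M}"
    then obtain i where "b = Suc (n + i)" by (auto dest!: le_Suc_ex)
    then show "esign y b / real b * hsum x (b - n) = esign y b / real b * hsum x (b - Suc n)
        + esign y b / real b * (esign x (b - n) / real (b - n))"
      using hsum_Suc[of x i] by (simp add: ring_distribs)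
  qed
  also have "(\<Sum>b=n+1..M. esign y b / real b * hsum x (b - Suc n))
      = (\<Sum>b=Suc n+1..M. esign y b / real b * hsum x (b - Suc n))"
    by (rule sum.mono_neutral_right) (auto simp: not_le le_Suc_eq)
  also have "(\<Sum>b=n+1..M. esign y b / real b * (esign x (b - n) / real (b - n)))
      = (\<Sum>b=n+1..M. (esign y n * (esign (x \<noteq> y) (b - n) / real (b - n))
          - esign x n * (esign (x \<noteq> y) b / real b)) / real n)"
  proof (intro sum.cong refl)
    fix b assume "b \<in> {n+1..M}"
    then have b: "n < b" "0 < b" by auto
    have "real (b - n) = real b - real n" using b by simp
    moreover have "esign y n * esign (x \<noteq> y) (b - n) = esign y b * esign x (b - n)"
      "esign x n * esign (x \<noteq> y) b = esign y b * esign x (b - n)"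
      using b by (auto simp: esign_xor esign_diff mult_ac)
    moreover have "s / real b * (t / (real b - real n))
        = (s * t / (real b - real n) - s * t / real b) / real n" for s t
      using b n by (simp add: field_simps)
    ultimately show "esign y b / real b * (esign x (b - n) / real (b - n))
      = (esign y n * (esign (x \<noteq> y) (b - n) / real (b - n))
          - esign x n * (esign (x \<noteq> y) b / real b)) / real n"
      by simp
  qed
  also have "\<dots> = (esign y n * (\<Sum>b=n+1..M. esign (x \<noteq> y) (b - n) / real (b - n))
          - esign x n * (\<Sum>b=n+1..M. esign (x \<noteq> y) b / real b)) / real n"
    by (simp add: sum_subtractf sum_distrib_left sum_divide_distrib diff_divide_distrib)
  also have "(\<Sum>b=n+1..M. esign (x \<noteq> y) (b - n) / real (b - n)) = hsum (x \<noteq> y) (M - n)"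
    unfolding hsum_eq
    by (rule sum.reindex_bij_witness[of _ "\<lambda>i. i + n" "\<lambda>i. i - n"]) auto
  also have "(\<Sum>b=n+1..M. esign (x \<noteq> y) b / real b) = hsum (x \<noteq> y) M - hsum (x \<noteq> y) n"
    using n by (subst hsum_diff_eq) auto
  finally show ?case
    using step.IH n
    by (cases n) simp_all
qed

text \<open>Summing over the outermost index first gives
  \<open>hsum x (M - n) - hsum x (m - n)\<close>; the second part, summed over \<open>m\<close>, is
  the correlation above.\<close>

lemma upper_conv_eq:
  assumes "1 \<le> n" "n \<le> M"
  shows "upper_conv x y M n = hsum x (M - n) * (hsum y M - hsum y n) - hsum2 y x M
    + (\<Sum>j=1..n-1. (esign y j * hsum (x \<noteq> y) (M - j)
          - esign x j * (hsum (x \<noteq> y) M - hsum (x \<noteq> y) j)) / real j)"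
proof -
  have "(\<Sum>a=m+1..M. esign y m * esign x (a - n) / (real m * real (a - n)))
      = esign y m / real m * (hsum x (M - n) - hsum x (m - n))" if m: "m \<in> {n+1..M}" for m
  proof -
    have "(\<Sum>a=m+1..M. esign x (a - n) / real (a - n)) = (\<Sum>i=m-n+1..M-n. esign x i / real i)"
      by (rule sum.reindex_bij_witness[of _ "\<lambda>i. i + n" "\<lambda>i. i - n"]) (use m in auto)
    also have "\<dots> = hsum x (M - n) - hsum x (m - n)"
      using m by (subst hsum_diff_eq) auto
    finally show ?thesis
      by (simp only: times_divide_times_eq[symmetric] sum_distrib_left[symmetric])
  qed
  then have "upper_conv x y M n
      = (\<Sum>m=n+1..M. esign y m / real m * hsum x (M - n) - esign y m / real m * hsum x (m - n))"
    unfolding upper_conv_def by (intro sum.cong refl) (simp add: right_diff_distrib)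
  also have "\<dots> = hsum x (M - n) * (hsum y M - hsum y n)
      - (\<Sum>m=n+1..M. esign y m / real m * hsum x (m - n))"
    unfolding sum_subtractf hsum_diff_eq[OF assms(2), of y] sum_distrib_left
    by (simp add: mult.commute)
  finally show ?thesis
    unfolding sum_hsum_correlation[OF assms] by simp
qed

section \<open>Replacing \<open>M - j\<close> by \<open>M\<close>: error bounds\<close>

lemma hsum_False_eq_harm: "hsum False n = harm n"
  by (simp add: hsum_eq harm_def esign_def inverse_eq_divide)

lemma abs_hsum_diff_le_hsum_False:
  assumes "n \<le> M"
  shows "\<bar>hsum x M - hsum x n\<bar> \<le> hsum False M"
proof -
  have "\<bar>hsum x M - hsum x n\<bar> \<le> (\<Sum>i=n+1..M. \<bar>esign x i / real i\<bar>)"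
    unfolding hsum_diff_eq[OF assms] by (rule sum_abs)
  also have "\<dots> \<le> (\<Sum>i=1..M. \<bar>esign x i / real i\<bar>)"
    by (rule sum_mono2) auto
  finally show ?thesis by (simp add: hsum_eq[of False] esign_def[of False] abs_divide)
qed

text \<open>The difference has \<open>j\<close> terms, each of absolute value at most
  \<open>1 / (M + 1 - j)\<close>.\<close>

lemma abs_hsum_diff_le:
  assumes "j \<le> M"
  shows "\<bar>hsum x (M - j) - hsum x M\<bar> \<le> real j / (real M + 1 - real j)"
proof -
  have "\<bar>hsum x M - hsum x (M - j)\<bar> \<le> (\<Sum>i=M-j+1..M. \<bar>esign x i / real i\<bar>)"
    by (subst hsum_diff_eq) (simp, rule sum_abs)
  also have "\<dots> \<le> (\<Sum>i=M-j+1..M. 1 / (real M + 1 - real j))"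
    by (rule sum_mono) (use assms in \<open>auto simp: abs_divide intro!: divide_left_mono\<close>)
  also have "\<dots> = real j / (real M + 1 - real j)"
    using assms by simp
  finally show ?thesis by (simp add: abs_minus_commute)
qed

text \<open>The closed form of \<open>upper_conv\<close> with every argument \<open>M - j\<close> replaced by \<open>M\<close>.\<close>

definition upper_approx :: "bool \<Rightarrow> bool \<Rightarrow> nat \<Rightarrow> nat \<Rightarrow> real" where
  "upper_approx x y M n = hsum x M * (hsum y M - hsum y n) - hsum2 y x M
     + hsum (x \<noteq> y) M * (hsum y (n - 1) - hsum x (n - 1)) + hsum2 x (x \<noteq> y) (n - 1) + qsum y (n - 1)"

text \<open>The replacement in the leading product costs \<open>n / (M + 1 - n)\<close> times a
  factor bounded by \<open>hsum False M\<close>. In the sum over \<open>j\<close> the weight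
  \<open>1 / j\<close> cancels the numerator of the error, so each of its \<open>n - 1\<close> terms
  costs at most \<open>1 / (M + 1 - n)\<close>.\<close>

lemma upper_conv_approx:
  assumes "1 \<le> n" "n \<le> M"
  shows "\<bar>upper_conv x y M n - upper_approx x y M n\<bar>
    \<le> (hsum False M + 1) * (real n / (real M + 1 - real n))"
proof -
  \<comment> \<open>Nested sums are strict, so the inclusive bound \<open>j\<close> adds a diagonal,
    whose sign is that of \<open>y\<close>.\<close>
  have "(\<Sum>j=1..n-1. esign x j / real j * hsum (x \<noteq> y) j) = hsum2 x (x \<noteq> y) (n - 1) + qsum y (n - 1)"
    unfolding hsum2_eq qsum_eq sum.distrib[symmetric]
  proof (intro sum.cong refl)
    fix j assume "j \<in> {1..n-1}"
    then obtain i where "j = Suc i" by (cases j) auto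
    then show "esign x j / real j * hsum (x \<noteq> y) j
        = esign x j / real j * hsum (x \<noteq> y) (j - 1) + esign y j / (real j)\<^sup>2"
      by (simp add: hsum_Suc esign_xor power2_eq_square ring_distribs del: of_nat_Suc)
  qed
  then have "upper_conv x y M n - upper_approx x y M n
      = (hsum x (M - n) - hsum x M) * (hsum y M - hsum y n)
      + (\<Sum>j=1..n-1. esign y j / real j * (hsum (x \<noteq> y) (M - j) - hsum (x \<noteq> y) M))"
    unfolding upper_conv_eq[OF assms] upper_approx_def hsum_eq[of x "n - 1"] hsum_eq[of y "n - 1"]
    by (simp add: algebra_simps sum_subtractf sum.distrib sum_distrib_left sum_divide_distrib
        diff_divide_distrib add_divide_distrib)
  also have "\<bar>\<dots>\<bar> \<le> \<bar>hsum x (M - n) - hsum x M\<bar> * \<bar>hsum y M - hsum y n\<bar>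
      + (\<Sum>j=1..n-1. \<bar>esign y j / real j * (hsum (x \<noteq> y) (M - j) - hsum (x \<noteq> y) M)\<bar>)"
    unfolding abs_mult[symmetric] by (intro order.trans[OF abs_triangle_ineq] add_mono order.refl sum_abs)
  also have "\<dots> \<le> real n / (real M + 1 - real n) * hsum False M
      + (\<Sum>j=1..n-1. 1 / (real M + 1 - real n))"
  proof (intro add_mono mult_mono sum_mono)
    fix j assume "j \<in> {1..n-1}"
    then have j: "1 \<le> j" "j < n" by auto
    have "\<bar>esign y j / real j * (hsum (x \<noteq> y) (M - j) - hsum (x \<noteq> y) M)\<bar>
        \<le> 1 / real j * (real j / (real M + 1 - real j))"
      unfolding abs_mult abs_divide using j assms
      by (intro mult_mono abs_hsum_diff_le) auto
    also have "\<dots> \<le> 1 / (real M + 1 - real n)"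
      using j assms by (auto intro!: divide_left_mono)
    finally show "\<bar>esign y j / real j * (hsum (x \<noteq> y) (M - j) - hsum (x \<noteq> y) M)\<bar>
        \<le> 1 / (real M + 1 - real n)" .
  qed (use assms in \<open>auto intro!: abs_hsum_diff_le abs_hsum_diff_le_hsum_False\<close>)
  also have "\<dots> \<le> (hsum False M + 1) * (real n / (real M + 1 - real n))"
    using assms
    by (simp add: ring_distribs mult_ac of_nat_diff divide_right_mono flip: add_divide_distrib)
  finally show ?thesis .
qed

text \<open>Partial fractions, followed by the reflection of \<open>n\<close> to
  \<open>M + 1 - n\<close>, give two equal harmonic sums.\<close>

lemma sum_inverse_mult_reflect:
  "(\<Sum>n=1..M. 1 / (real n * (real M + 1 - real n))) = 2 * hsum False M / (real M + 1)"
proof -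
  have "(\<Sum>n=1..M. 1 / (real n * (real M + 1 - real n)))
      = (\<Sum>n=1..M. (1 / real n + 1 / (real M + 1 - real n)) / (real M + 1))"
    by (intro sum.cong refl) (auto simp: divide_simps)
  also have "\<dots> = ((\<Sum>n=1..M. 1 / real n) + (\<Sum>n=1..M. 1 / (real M + 1 - real n))) / (real M + 1)"
    by (simp add: sum.distrib sum_divide_distrib add_divide_distrib)
  also have "(\<Sum>n=1..M. 1 / (real M + 1 - real n)) = (\<Sum>n=1..M. 1 / real n)"
    by (rule sum.reindex_bij_witness[of _ "\<lambda>i. M + 1 - i" "\<lambda>i. M + 1 - i"]) (auto simp: of_nat_diff)
  finally show ?thesis by (simp add: hsum_eq esign_def)
qed

section \<open>Growth, convergence and regularization of truncated sums\<close>

lemma hsum_False_le: "hsum False n \<le> 1 + ln (real n + 1)"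
proof (cases "n = 0")
  case False
  then have "harm n \<le> ln (real n) + 1"
    \<comment> \<open>The decreasing sequence is indexed from 0, which stands for
      \<open>harm 1 - ln 1 = 1\<close>.\<close>
    using decseqD[OF decseq_harm_diff_ln, of 0 "n - 1"] by (simp add: harm_def)
  moreover have "ln (real n) \<le> ln (real n + 1)" using False by simp
  ultimately show ?thesis by (simp add: hsum_False_eq_harm)
qed simp

lemma hsum_False_nonneg: "0 \<le> hsum False n"
  by (simp add: hsum_False_eq_harm harm_nonneg)

lemma hsum_False_mono: "m \<le> n \<Longrightarrow> hsum False m \<le> hsum False n"
  by (simp add: hsum_False_eq_harm harm_mono)

lemma hsum_False_power_over_tendsto_0: "(\<lambda>n. hsum False n ^ k / (real n + 1)) \<longlonglongrightarrow> 0"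
proof (rule Lim_null_comparison)
  show "(\<lambda>n. (1 + ln (real n + 1)) ^ k / (real n + 1)) \<longlonglongrightarrow> 0" by real_asymp
  show "\<forall>\<^sub>F n in sequentially. norm (hsum False n ^ k / (real n + 1)) \<le> (1 + ln (real n + 1)) ^ k / (real n + 1)"
    by (intro always_eventually allI)
      (auto simp: hsum_False_nonneg hsum_False_le intro!: divide_right_mono power_mono)
qed

lemma hsum_False_power_summable: "summable (\<lambda>n. hsum False n ^ k / (real n + 1)\<^sup>2)"
proof (rule summable_comparison_test_bigo)
  \<comment> \<open>The exponent lies strictly between -2 and -1, which leaves room for any power of
    the logarithm.\<close>
  show "summable (\<lambda>n. norm (real n powr (-3/2)))"
    by (simp add: summable_real_powr_iff)
  have "(\<lambda>n. hsum False n ^ k / (real n + 1)\<^sup>2) \<in> O(\<lambda>n. (1 + ln (real n + 1)) ^ k / (real n + 1)\<^sup>2)"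
    by (intro bigoI[of _ 1] always_eventually allI)
      (auto simp: hsum_False_nonneg hsum_False_le intro!: divide_right_mono power_mono)
  also have "(\<lambda>n. (1 + ln (real n + 1)) ^ k / (real n + 1)\<^sup>2) \<in> O(\<lambda>n. real n powr (-3/2))"
    by real_asymp
  finally show "(\<lambda>n. hsum False n ^ k / (real n + 1)\<^sup>2) \<in> O(\<lambda>n. real n powr (-3/2))" .
qed

text \<open>Since every exponent is at least 1, each nested summation costs at most one factor
  \<open>hsum False n\<close>; truncated sums thus grow no faster than a power of the
  logarithm.\<close>

lemma abs_zeta_trunc_le:
  assumes "\<forall>(s, b)\<in>set xs. 1 \<le> s"
  shows "\<bar>zeta_trunc xs n\<bar> \<le> hsum False n ^ length xs"
  using assms
proof (induction xs arbitrary: n)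
  case (Cons p xs)
  obtain s b where p: "p = (s, b)" by force
  have "\<bar>zeta_trunc (p # xs) n\<bar> \<le> (\<Sum>i=1..n. \<bar>esign b i / real i ^ s * zeta_trunc xs (i - 1)\<bar>)"
    unfolding p zeta_trunc.simps by (rule sum_abs)
  also have "\<dots> \<le> (\<Sum>i=1..n. 1 / real i * hsum False n ^ length xs)"
  proof (rule sum_mono)
    fix i assume i: "i \<in> {1..n}"
    have "\<bar>zeta_trunc xs (i - 1)\<bar> \<le> hsum False (i - 1) ^ length xs"
      using Cons by auto
    also have "\<dots> \<le> hsum False n ^ length xs"
      using i by (intro power_mono hsum_False_mono hsum_False_nonneg) auto
    finally have "\<bar>zeta_trunc xs (i - 1)\<bar> \<le> hsum False n ^ length xs" .
    moreover have "1 / real i ^ s \<le> 1 / real i ^ 1"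
      using i Cons.prems p by (intro divide_left_mono power_increasing) auto
    ultimately show "\<bar>esign b i / real i ^ s * zeta_trunc xs (i - 1)\<bar>
        \<le> 1 / real i * hsum False n ^ length xs"
      unfolding abs_mult abs_divide by (intro mult_mono) auto
  qed
  also have "\<dots> = hsum False n ^ length (p # xs)"
    unfolding sum_distrib_right[symmetric] by (simp add: hsum_eq esign_def)
  finally show ?case .
qed simp

text \<open>Alternating series test with bounded variation in place of monotonicity: averaging the
  series with its own shift leaves an absolutely convergent series and boundary terms that
  converge.\<close>

lemma convergent_alternating_bounded_variation:
  fixes c :: "nat \<Rightarrow> real"
  assumes "c \<longlonglongrightarrow> 0" and "summable (\<lambda>n. \<bar>c n - c (Suc n)\<bar>)"
  shows "convergent (\<lambda>M. \<Sum>n<M. (-1) ^ n * c n)"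
proof -
  have eq: "(\<Sum>n<M. (-1) ^ n * c n)
      = ((\<Sum>n<M. (-1) ^ n * (c n - c (Suc n))) + c 0 - (-1) ^ M * c M) / 2" for M
    by (induction M) (auto simp: algebra_simps)
  have "summable (\<lambda>n. (-1) ^ n * (c n - c (Suc n)))"
    by (rule summable_comparison_test'[OF assms(2)]) (simp add: abs_mult)
  then obtain l where "(\<lambda>M. \<Sum>n<M. (-1) ^ n * (c n - c (Suc n))) \<longlonglongrightarrow> l"
    by (auto simp: summable_iff_convergent convergent_def)
  moreover have "(\<lambda>M. (-1) ^ M * c M) \<longlonglongrightarrow> 0"
    by (rule Lim_null_comparison[OF _ tendsto_rabs_zero[OF assms(1)]]) (simp add: abs_mult)
  ultimately have "(\<lambda>M. ((\<Sum>n<M. (-1) ^ n * (c n - c (Suc n))) + c 0 - (-1) ^ M * c M) / 2)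
      \<longlonglongrightarrow> (l + c 0 - 0) / 2"
    by (intro tendsto_divide tendsto_diff tendsto_add tendsto_const) auto
  then show ?thesis unfolding eq by (rule convergentI)
qed

lemma zeta_trunc_eq_sum_lessThan:
  "zeta_trunc ((s, b) # xs) M
     = (\<Sum>n<M. esign b (Suc n) / real (Suc n) ^ s * zeta_trunc xs n)"
  by (induction M) (simp_all add: zeta_trunc_Suc)

lemma convergent_zeta_trunc:
  assumes pos: "\<forall>(s, b)\<in>set ((s, b) # xs). 1 \<le> s" and "s \<noteq> 1 \<or> b"
  shows "convergent (zeta_trunc ((s, b) # xs))"
proof (cases "s = 1")
  case False
  with pos have s: "2 \<le> s" by auto
  have "summable (\<lambda>n. esign b (Suc n) / real (Suc n) ^ s * zeta_trunc xs n)"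
  proof (rule summable_comparison_test'[OF hsum_False_power_summable[of "length xs"]])
    fix n
    have "1 / real (Suc n) ^ s \<le> 1 / real (Suc n) ^ 2"
      using s by (intro divide_left_mono power_increasing) auto
    then have "1 / real (Suc n) ^ s * \<bar>zeta_trunc xs n\<bar>
        \<le> 1 / real (Suc n) ^ 2 * hsum False n ^ length xs"
      using pos by (intro mult_mono abs_zeta_trunc_le) auto
    then show "norm (esign b (Suc n) / real (Suc n) ^ s * zeta_trunc xs n)
        \<le> hsum False n ^ length xs / (real n + 1)\<^sup>2"
      by (simp add: abs_mult abs_divide add.commute)
  qed
  then show ?thesis
    unfolding zeta_trunc_eq_sum_lessThan[abs_def] by (simp add: summable_iff_convergent)
next
  case True
  with assms have s: "s = 1" "b" by auto
  \<comment> \<open>For a leading barred 1 there is no absolute convergence, so bounded variation of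
    \<open>c\<close> is shown instead.\<close>
  define c where "c n = zeta_trunc xs n / (real n + 1)" for n
  define k where "k = length xs"
  have "c \<longlonglongrightarrow> 0"
  proof (rule Lim_null_comparison[OF always_eventually hsum_False_power_over_tendsto_0[of k]], rule allI)
    fix n show "norm (c n) \<le> hsum False n ^ k / (real n + 1)"
      unfolding c_def k_def using abs_zeta_trunc_le[of xs n] pos
      by (auto simp: abs_divide intro!: divide_right_mono)
  qed
  moreover have "summable (\<lambda>n. \<bar>c n - c (Suc n)\<bar>)"
  proof (rule summable_comparison_test'[OF summable_add[OF hsum_False_power_summable[of k]
          hsum_False_power_summable[of "k - 1"]]])
    fix n
    define d where "d = zeta_trunc xs (Suc n) - zeta_trunc xs n"
    \<comment> \<open>One increment strips one level of nesting. For empty \<open>xs\<close> the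
      increment is 0, so truncated subtraction in \<open>k - 1\<close> does no harm.\<close>
    have d: "\<bar>d\<bar> \<le> hsum False n ^ (k - 1) / (real n + 1)"
    proof (cases xs)
      case Nil
      then show ?thesis by (simp add: d_def k_def)
    next
      case (Cons p ys)
      obtain t e where p: "p = (t, e)" by force
      have "1 / real (Suc n) ^ t \<le> 1 / real (Suc n) ^ 1"
        using pos Cons p by (intro divide_left_mono power_increasing) auto
      then have "1 / real (Suc n) ^ t * \<bar>zeta_trunc ys n\<bar>
          \<le> 1 / real (Suc n) * hsum False n ^ length ys"
        using pos Cons by (intro mult_mono abs_zeta_trunc_le) auto
      then show ?thesis
        by (simp add: d_def k_def Cons p zeta_trunc_Suc abs_mult abs_divide add.commute)
    qed
    have "c n - c (Suc n) = zeta_trunc xs n / ((real n + 1) * (real n + 2)) - d / (real n + 2)"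
      unfolding c_def d_def by (simp add: divide_simps) (simp add: algebra_simps)
    also have "\<bar>\<dots>\<bar> \<le> \<bar>zeta_trunc xs n\<bar> / ((real n + 1) * (real n + 2)) + \<bar>d\<bar> / (real n + 2)"
      by (rule order.trans[OF abs_triangle_ineq4]) (simp add: abs_divide abs_mult)
    also have "\<dots> \<le> hsum False n ^ k / ((real n + 1) * (real n + 1))
        + hsum False n ^ (k - 1) / (real n + 1) / (real n + 1)"
      using d abs_zeta_trunc_le[of xs n] pos unfolding k_def
      by (intro add_mono frac_le mult_mono) (auto simp: hsum_False_nonneg)
    finally show "norm \<bar>c n - c (Suc n)\<bar>
        \<le> hsum False n ^ k / (real n + 1)\<^sup>2 + hsum False n ^ (k - 1) / (real n + 1)\<^sup>2"
      by (simp add: power2_eq_square)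
  qed
  ultimately have "convergent (\<lambda>M. - (\<Sum>n<M. (-1) ^ n * c n))"
    by (intro convergent_minus_iff[THEN iffD1] convergent_alternating_bounded_variation)
  then show ?thesis
    using s unfolding zeta_trunc_eq_sum_lessThan[abs_def] c_def
    by (simp add: esign_def add.commute sum_negf)
qed

lemma zeta_trunc_tendsto_zeta:
  assumes "\<forall>(s, b)\<in>set ((s, b) # xs). 1 \<le> s" and "s \<noteq> 1 \<or> b"
  shows "zeta_trunc ((s, b) # xs) \<longlonglongrightarrow> zeta ((s, b) # xs)"
  using convergent_zeta_trunc[OF assms] by (simp add: zeta_def convergent_LIMSEQ_iff)

text \<open>The constant polynomial has the defining property. It is the only one, because a
  nonconstant polynomial is unbounded along \<open>ln M + euler_mascheroni\<close>, which tends to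
  infinity.\<close>

lemma zeta_st_convergent:
  assumes "\<forall>(s, b)\<in>set ((s, b) # xs). 1 \<le> s" and "s \<noteq> 1 \<or> b"
  shows "zeta_st ((s, b) # xs) = [:zeta ((s, b) # xs):]"
  unfolding zeta_st_def
proof (rule the_equality)
  let ?z = "zeta ((s, b) # xs)"
  have lim: "(\<lambda>M. zeta_trunc ((s, b) # xs) M - ?z) \<longlonglongrightarrow> 0"
    using zeta_trunc_tendsto_zeta[OF assms] by (simp add: LIM_zero_iff)
  then show "(\<lambda>M. zeta_trunc ((s, b) # xs) M - poly [:?z:] (ln (real M) + euler_mascheroni)) \<longlonglongrightarrow> 0"
    by simp
  fix P assume "(\<lambda>M. zeta_trunc ((s, b) # xs) M - poly P (ln (real M) + euler_mascheroni)) \<longlonglongrightarrow> 0"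
  from tendsto_diff[OF lim this]
  have lim0: "(\<lambda>M. poly (P - [:?z:]) (ln (real M) + euler_mascheroni)) \<longlonglongrightarrow> 0"
    by simp
  have inf: "filterlim (\<lambda>M. ln (real M) + (euler_mascheroni::real)) at_infinity sequentially"
    by real_asymp
  show "P = [:?z:]"
  proof (rule ccontr)
    assume "P \<noteq> [:?z:]"
    then have nz: "P - [:?z:] \<noteq> 0" by simp
    show False
    proof (cases "degree (P - [:?z:]) = 0")
      case True
      then obtain a where "P - [:?z:] = [:a:]" by (rule degree_eq_zeroE)
      with lim0 nz show False by (simp add: LIMSEQ_const_iff)
    next
      case False
      then have "filterlim (poly (P - [:?z:])) at_infinity at_infinity"
        by (intro filterlim_poly_at_infinity) auto
      from filterlim_compose[OF this inf] lim0 show False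
        by (auto dest: not_tendsto_and_filterlim_at_infinity[rotated])
    qed
  qed
qed

section \<open>Truncated Euler sums as weighted single sums\<close>

text \<open>With the weight \<open>1 / n ^ u\<close> fixed, identities between truncated sums reduce
  to identities between the coefficients \<open>f\<close>, which may depend on
  \<open>M\<close>.\<close>

definition psum :: "nat \<Rightarrow> nat \<Rightarrow> (nat \<Rightarrow> real) \<Rightarrow> real" where
  "psum u M f = (\<Sum>n=1..M. f n / real n ^ u)"

lemma psum_linear:
  "psum u M f + psum u M g = psum u M (\<lambda>n. f n + g n)"
  "psum u M f - psum u M g = psum u M (\<lambda>n. f n - g n)"
  "a * psum u M f = psum u M (\<lambda>n. a * f n)"
  by (simp_all add: psum_def sum.distrib sum_subtractf sum_distrib_left
      add_divide_distrib diff_divide_distrib)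

lemma psum_cong: "(\<And>n. n < M \<Longrightarrow> f (Suc n) = g (Suc n)) \<Longrightarrow> psum u M f = psum u M g"
  unfolding psum_def by (intro sum.cong refl) (auto simp: Suc_le_eq gr0_conv_Suc)

text \<open>Once the parity of the index is fixed, every sign is a constant 1 or -1 and the
  comparison becomes plain algebra.\<close>

lemma psum_cong_parity:
  assumes "\<And>n. esign True (Suc n) = 1 \<Longrightarrow> f (Suc n) = g (Suc n)"
    and "\<And>n. esign True (Suc n) = -1 \<Longrightarrow> f (Suc n) = g (Suc n)"
  shows "psum u M f = psum u M g"
proof (rule psum_cong)
  fix n
  have "esign True (Suc n) = 1 \<or> esign True (Suc n) = -1"
    by (cases "even n") (simp_all add: esign_def)
  then show "f (Suc n) = g (Suc n)" using assms by blast
qed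

text \<open>Here the outermost index carries \<open>u\<close>; surplus powers of
  \<open>1 / n\<close> move into the coefficient.\<close>

lemma zeta_trunc_eq_psum_outer:
  "zeta_trunc [(u, q)] M = psum u M (esign q)"
  "zeta_trunc [(u + 2, q)] M = psum u M (\<lambda>n. esign q n / real n ^ 2)"
  "zeta_trunc [(u, q), (2, x)] M = psum u M (\<lambda>n. esign q n * qsum x (n - 1))"
  "zeta_trunc [(u + 1, q), (1, x)] M = psum u M (\<lambda>n. esign q n / real n * hsum x (n - 1))"
  "zeta_trunc [(u, q), (1, x), (1, y)] M = psum u M (\<lambda>n. esign q n * hsum2 x y (n - 1))"
  unfolding zeta_trunc.simps(2)[of u] zeta_trunc.simps(2)[of "u + 1"] zeta_trunc.simps(2)[of "u + 2"]
    hsum_def[symmetric] hsum2_def[symmetric] qsum_def[symmetric] psum_def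
  by (simp_all add: power_add mult_ac power2_eq_square)

text \<open>Taking the second index as the free variable \<open>n\<close> leaves the first one to
  run over \<open>n < i \<le> M\<close>, which is a difference of depth-one sums.\<close>

lemma zeta_trunc_swap:
  "zeta_trunc ((s, x) # (t, q) # ys) M = psum t M
     (\<lambda>n. esign q n * zeta_trunc ys (n - 1) * (zeta_trunc [(s, x)] M - zeta_trunc [(s, x)] n))"
proof -
  have "zeta_trunc ((s, x) # (t, q) # ys) M = (\<Sum>n=1..M. \<Sum>m=1..n-1.
      esign x n / real n ^ s * (esign q m / real m ^ t * zeta_trunc ys (m - 1)))"
    by (simp only: zeta_trunc.simps sum_distrib_left)
  also have "\<dots> = (\<Sum>m=1..M. \<Sum>n=m+1..M.
      esign x n / real n ^ s * (esign q m / real m ^ t * zeta_trunc ys (m - 1)))"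
    by (rule sum_triangle_swap)
  also have "\<dots> = (\<Sum>m=1..M. (zeta_trunc [(s, x)] M - zeta_trunc [(s, x)] m)
      * (esign q m / real m ^ t * zeta_trunc ys (m - 1)))"
    unfolding sum_distrib_right[symmetric]
  proof (intro sum.cong refl arg_cong2[where f = "(*)"])
    fix m assume "m \<in> {1..M}"
    then have "m \<le> M" by simp
    then show "(\<Sum>n=m+1..M. esign x n / real n ^ s) = zeta_trunc [(s, x)] M - zeta_trunc [(s, x)] m"
      by (induction M rule: dec_induct) (auto simp: zeta_trunc_Suc)
  qed
  finally show ?thesis by (simp add: psum_def mult_ac)
qed

lemma zeta_trunc_eq_psum_inner:
  "zeta_trunc [(2, x), (u, q)] M = psum u M (\<lambda>n. esign q n * (qsum x M - qsum x n))"
  "zeta_trunc [(1, x), (u + 1, q)] M = psum u M (\<lambda>n. esign q n / real n * (hsum x M - hsum x n))"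
  "zeta_trunc [(1, x), (u, q), (1, y)] M
     = psum u M (\<lambda>n. esign q n * hsum y (n - 1) * (hsum x M - hsum x n))"
  unfolding zeta_trunc_swap hsum_def[symmetric] qsum_def[symmetric]
  by (simp_all add: psum_def mult_ac)

text \<open>The two outer indices form decreasing pairs above \<open>n\<close>. From all pairs up to
  \<open>M\<close> one removes those whose larger index is at most \<open>n\<close> and those with
  only the smaller index at most \<open>n\<close>.\<close>

lemma zeta_trunc_eq_psum_innermost:
  "zeta_trunc [(1, x), (1, y), (u, q)] M = psum u M (\<lambda>n. esign q n *
     (hsum2 x y M - hsum2 x y n - (hsum x M - hsum x n) * hsum y n))"
proof (induction M)
  case (Suc M)
  have eq: "zeta_trunc [(1, y), (u, q)] M = psum u M (\<lambda>n. esign q n * (hsum y M - hsum y n))"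
    unfolding zeta_trunc_swap hsum_def[symmetric] by simp
  have "zeta_trunc [(1, x), (1, y), (u, q)] (Suc M)
      = psum u M (\<lambda>n. esign q n * (hsum2 x y M - hsum2 x y n - (hsum x M - hsum x n) * hsum y n)
          + esign x (Suc M) / real (Suc M) * (esign q n * (hsum y M - hsum y n)))"
    unfolding zeta_trunc_Suc[of 1 x] Suc.IH eq psum_linear by simp
  also have "\<dots> = psum u M (\<lambda>n. esign q n *
     (hsum2 x y (Suc M) - hsum2 x y n - (hsum x (Suc M) - hsum x n) * hsum y n))"
    by (intro psum_cong) (simp add: hsum2_Suc[of _ _ M] hsum_Suc[of _ M] algebra_simps)
  finally show ?case by (simp add: psum_def)
qed (simp add: psum_def)

lemmas zeta_trunc_eq_psum =
  zeta_trunc_eq_psum_outer zeta_trunc_eq_psum_inner zeta_trunc_eq_psum_innermost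

section \<open>Passage to the limit\<close>

text \<open>Because \<open>u \<ge> 2\<close>, the weight \<open>1 / n ^ u\<close> absorbs the factor
  \<open>n\<close> of the pointwise error, leaving \<open>1 / (n * (M + 1 - n))\<close>. The total
  is of order \<open>hsum False M ^ 2 / (M + 1)\<close>.\<close>

lemma sum_zeta_trunc_3_asymp:
  assumes "2 \<le> u"
  shows "(\<lambda>M. (\<Sum>a=1..u. zeta_trunc [(a, x), (1, y), (u + 1 - a, z)] M)
    - psum u M (\<lambda>n. esign (x \<noteq> z) n * (upper_approx x y M n - lower_conv y z n))) \<longlonglongrightarrow> 0"
proof (rule Lim_null_comparison[OF always_eventually], rule allI)
  fix M
  have "(\<Sum>a=1..u. zeta_trunc [(a, x), (1, y), (u + 1 - a, z)] M)
      - psum u M (\<lambda>n. esign (x \<noteq> z) n * (upper_approx x y M n - lower_conv y z n))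
    = (\<Sum>n=1..M. esign (x \<noteq> z) n / real n ^ u * (upper_conv x y M n - upper_approx x y M n))"
    unfolding sum_zeta_trunc_3 psum_def sum_subtractf[symmetric]
    by (intro sum.cong refl) (simp add: algebra_simps diff_divide_distrib add_divide_distrib)
  also have "norm \<dots> \<le> (\<Sum>n=1..M. \<bar>esign (x \<noteq> z) n / real n ^ u * (upper_conv x y M n - upper_approx x y M n)\<bar>)"
    unfolding real_norm_def by (rule sum_abs)
  also have "\<dots> \<le> (\<Sum>n=1..M. (hsum False M + 1) * (1 / (real n * (real M + 1 - real n))))"
  proof (rule sum_mono)
    fix n assume n: "n \<in> {1..M}"
    have "1 / real n ^ u \<le> 1 / real n ^ 2"
      using n assms by (intro divide_left_mono power_increasing) auto
    then have "1 / real n ^ u * \<bar>upper_conv x y M n - upper_approx x y M n\<bar>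
        \<le> 1 / real n ^ 2 * ((hsum False M + 1) * (real n / (real M + 1 - real n)))"
      using n by (intro mult_mono upper_conv_approx) auto
    then show "\<bar>esign (x \<noteq> z) n / real n ^ u * (upper_conv x y M n - upper_approx x y M n)\<bar>
        \<le> (hsum False M + 1) * (1 / (real n * (real M + 1 - real n)))"
      unfolding abs_mult abs_divide abs_esign using n by (simp add: power2_eq_square)
  qed
  also have "\<dots> = 2 * (hsum False M ^ 2 / (real M + 1)) + 2 * (hsum False M ^ 1 / (real M + 1))"
    unfolding sum_distrib_left[symmetric] sum_inverse_mult_reflect
    by (simp add: power2_eq_square algebra_simps add_divide_distrib)
  finally show "norm ((\<Sum>a=1..u. zeta_trunc [(a, x), (1, y), (u + 1 - a, z)] M)
      - psum u M (\<lambda>n. esign (x \<noteq> z) n * (upper_approx x y M n - lower_conv y z n)))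
    \<le> 2 * (hsum False M ^ 2 / (real M + 1)) + 2 * (hsum False M ^ 1 / (real M + 1))" .
next
  show "(\<lambda>M. 2 * (hsum False M ^ 2 / (real M + 1)) + 2 * (hsum False M ^ 1 / (real M + 1))) \<longlonglongrightarrow> 0"
    using tendsto_add[OF tendsto_mult_right_zero[OF hsum_False_power_over_tendsto_0[of 2], of 2]
        tendsto_mult_right_zero[OF hsum_False_power_over_tendsto_0[of 1], of 2]] by simp
qed

text \<open>The bar on the first argument makes every term on the left converge, so limits can be
  compared directly. Here \<open>q\<close> is the simplified form of
  \<open>True \<noteq> z\<close>.\<close>

lemma sum_zeta_eq:
  assumes u: "2 \<le> u" and q: "q = (\<not> z)" and lim: "r \<longlonglongrightarrow> l"
    and eq: "\<And>M. psum u M (\<lambda>n. esign q n * (upper_approx True y M n - lower_conv y z n)) = r M"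
  shows "(\<Sum>a=1..u. zeta [(a, True), (1, y), (u + 1 - a, z)]) = l"
proof (rule LIMSEQ_unique)
  show "(\<lambda>M. \<Sum>a=1..u. zeta_trunc [(a, True), (1, y), (u + 1 - a, z)] M)
      \<longlonglongrightarrow> (\<Sum>a=1..u. zeta [(a, True), (1, y), (u + 1 - a, z)])"
    by (intro tendsto_sum zeta_trunc_tendsto_zeta) auto
  show "(\<lambda>M. \<Sum>a=1..u. zeta_trunc [(a, True), (1, y), (u + 1 - a, z)] M) \<longlonglongrightarrow> l"
    using tendsto_add[OF sum_zeta_trunc_3_asymp[OF u, of True y z] lim] by (simp add: q eq[unfolded q])
qed

lemma sum_zeta_st_eq:
  assumes u: "2 \<le> u" and lim: "r \<longlonglongrightarrow> l"
    and eq: "\<And>M. psum u M (\<lambda>n. esign z n * (upper_approx False y M n - lower_conv y z n))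
      = zeta_trunc [(1, False), (1, y), (u, z)] M + r M"
  shows "(\<Sum>a=1..u. zeta_st [(a, False), (1, y), (u + 1 - a, z)])
    = zeta_st [(1, False), (1, y), (u, z)] + [:l:]"
proof -
  have first_term: "(\<Sum>a=1..u. f a) = f 1 + (\<Sum>a=2..u. f a)" for f :: "nat \<Rightarrow> 'a::comm_monoid_add"
    using u by (simp add: sum.atLeast_Suc_atMost numeral_2_eq_2)
  have "(\<Sum>a=2..u. zeta [(a, False), (1, y), (u + 1 - a, z)]) = l"
  proof (rule LIMSEQ_unique)
    show "(\<lambda>M. \<Sum>a=2..u. zeta_trunc [(a, False), (1, y), (u + 1 - a, z)] M)
        \<longlonglongrightarrow> (\<Sum>a=2..u. zeta [(a, False), (1, y), (u + 1 - a, z)])"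
      by (intro tendsto_sum zeta_trunc_tendsto_zeta) auto
    show "(\<lambda>M. \<Sum>a=2..u. zeta_trunc [(a, False), (1, y), (u + 1 - a, z)] M) \<longlonglongrightarrow> l"
      using tendsto_add[OF sum_zeta_trunc_3_asymp[OF u, of False y z] lim]
      \<comment> \<open>The divergent term \<open>a = 1\<close> cancels at the level of truncated
        sums, before any limit is taken.\<close>
      by (simp add: eq first_term del: One_nat_def)
  qed
  moreover have "(\<Sum>a=2..u. zeta_st [(a, False), (1, y), (u + 1 - a, z)])
      = (\<Sum>a=2..u. [:zeta [(a, False), (1, y), (u + 1 - a, z)]:])"
    by (intro sum.cong refl zeta_st_convergent) auto
  moreover have "(\<Sum>a\<in>A. [:f a:]) = [:\<Sum>a\<in>A. f a:]" for f :: "nat \<Rightarrow> real" and A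
    by (induction A rule: infinite_finite_induct) auto
  ultimately show ?thesis
    unfolding first_term by simp
qed

section \<open>Relations in weight two\<close>

lemma abs_hsum_True_diff_le:
  assumes "j \<le> n"
  shows "\<bar>hsum True n - hsum True j\<bar> \<le> 1 / (real j + 1)"
proof -
  \<comment> \<open>Leibniz estimate by downward induction: multiplied by the sign of its first
    term, the tail lies between 0 and the size of that term.\<close>
  have "0 \<le> (-1) ^ Suc j * (hsum True n - hsum True j) \<and>
      (-1) ^ Suc j * (hsum True n - hsum True j) \<le> 1 / (real j + 1)"
    using assms
  proof (induction rule: inc_induct)
    case (step j)
    have "(-1) ^ Suc j * (hsum True n - hsum True j)
        = 1 / (real j + 1) - (-1) ^ Suc (Suc j) * (hsum True n - hsum True (Suc j))"
      by (simp add: hsum_Suc esign_def algebra_simps)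
    moreover have "1 / (real (Suc j) + 1) \<le> 1 / (real j + 1)"
      by (intro divide_left_mono) auto
    ultimately show ?case using step.IH by linarith
  qed simp
  then have "\<bar>(-1) ^ Suc j * (hsum True n - hsum True j)\<bar> \<le> 1 / (real j + 1)"
    by linarith
  then show ?thesis by (simp add: abs_mult)
qed

text \<open>In the limit this is the shuffle relation \<open>\<zeta>(-1)\<^sup>2 = 2 \<zeta>(-1, 1)\<close> (a minus sign marks a bar).\<close>

lemma hsum_True_shuffle: "(\<lambda>n. hsum True n ^ 2 - 2 * hsum2 True False n) \<longlonglongrightarrow> 0"
proof (rule Lim_null_comparison[OF always_eventually], rule allI)
  fix n
  have "2 * hsum2 True False n = (\<Sum>b=1..n-1. esign True b / real b * hsum True (n - b))"
    unfolding sum_hsum_convolution by simp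
  also have "\<dots> = (\<Sum>b=1..n. esign True b / real b * hsum True (n - b))"
    by (cases n) auto
  \<comment> \<open>The square runs over all pairs up to \<open>n\<close>, the convolution only over
    pairs with sum at most \<open>n\<close>; the difference consists of alternating tails.\<close>
  finally have "hsum True n ^ 2 - 2 * hsum2 True False n
      = (\<Sum>b=1..n. esign True b / real b * (hsum True n - hsum True (n - b)))"
    unfolding right_diff_distrib sum_subtractf sum_distrib_right[symmetric] hsum_eq[symmetric]
    by (simp add: power2_eq_square)
  also have "norm \<dots> \<le> (\<Sum>b=1..n. \<bar>esign True b / real b * (hsum True n - hsum True (n - b))\<bar>)"
    unfolding real_norm_def by (rule sum_abs)
  also have "\<dots> \<le> (\<Sum>b=1..n. 1 / (real b * (real n + 1 - real b)))"
  proof (rule sum_mono)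
    fix b assume b: "b \<in> {1..n}"
    then have "\<bar>hsum True n - hsum True (n - b)\<bar> \<le> 1 / (real n + 1 - real b)"
      using abs_hsum_True_diff_le[of "n - b" n] by (simp add: of_nat_diff algebra_simps)
    then have "1 / real b * \<bar>hsum True n - hsum True (n - b)\<bar> \<le> 1 / real b * (1 / (real n + 1 - real b))"
      by (intro mult_left_mono) auto
    then show "\<bar>esign True b / real b * (hsum True n - hsum True (n - b))\<bar>
        \<le> 1 / (real b * (real n + 1 - real b))"
      by (simp add: abs_mult abs_divide)
  qed
  finally show "norm (hsum True n ^ 2 - 2 * hsum2 True False n) \<le> 2 * (hsum False n ^ 1 / (real n + 1))"
    unfolding sum_inverse_mult_reflect by simp
next
  show "(\<lambda>n. 2 * (hsum False n ^ 1 / (real n + 1))) \<longlonglongrightarrow> 0"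
    by (rule tendsto_mult_right_zero[OF hsum_False_power_over_tendsto_0])
qed

text \<open>Adding the alternating and the plain sum up to \<open>2 * n\<close> leaves twice the
  even terms, that is half of \<open>qsum False n\<close>. Comparing limits gives the
  relation.\<close>

lemma qsum_True_False: "(\<lambda>n. 2 * qsum True n + qsum False n) \<longlonglongrightarrow> 0"
proof -
  have lim: "qsum b \<longlonglongrightarrow> zeta [(2, b)]" for b
    unfolding qsum_def[abs_def] by (rule zeta_trunc_tendsto_zeta) auto
  have eq: "qsum True (2 * n) + qsum False (2 * n) = qsum False n / 2" for n
  proof (induction n)
    case (Suc n)
    have "real (Suc (Suc (2 * n))) = 2 * real (Suc n)" by simp
    then show ?case
      using Suc by (simp add: qsum_Suc esign_def power_mult_distrib add_divide_distrib del: of_nat_Suc)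
  qed simp
  have "strict_mono (\<lambda>n::nat. 2 * n)" by (simp add: strict_mono_def)
  then have "(\<lambda>n. qsum b (2 * n)) \<longlonglongrightarrow> zeta [(2, b)]" for b
    using LIMSEQ_subseq_LIMSEQ[OF lim] by (simp add: o_def)
  from tendsto_add[OF this this]
  have "(\<lambda>n. qsum False n / 2) \<longlonglongrightarrow> zeta [(2, True)] + zeta [(2, False)]"
    unfolding eq[symmetric] .
  moreover have "(\<lambda>n. qsum False n / 2) \<longlonglongrightarrow> zeta [(2, False)] / 2"
    by (intro tendsto_intros lim) auto
  ultimately have "zeta [(2, True)] + zeta [(2, False)] = zeta [(2, False)] / 2"
    by (rule LIMSEQ_unique)
  then have "2 * zeta [(2, True)] + zeta [(2, False)] = 0" by simp
  moreover have "(\<lambda>n. 2 * qsum True n + qsum False n) \<longlonglongrightarrow> 2 * zeta [(2, True)] + zeta [(2, False)]"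
    by (intro tendsto_intros lim)
  ultimately show ?thesis by simp
qed

text \<open>Half the difference of the two preceding null sequences, after the stuffle product has
  eliminated \<open>hsum2 True True\<close>.\<close>

lemma hsum2_weight_two_relation:
  "(\<lambda>n. hsum2 True False n + qsum True n - hsum2 True True n) \<longlonglongrightarrow> 0"
proof -
  have "hsum2 True False n + qsum True n - hsum2 True True n
      = (2 * qsum True n + qsum False n) / 2 - (hsum True n ^ 2 - 2 * hsum2 True False n) / 2" for n
    using hsum_mult_hsum[of True n True] by (simp add: power2_eq_square field_simps)
  moreover have "(\<lambda>n. (2 * qsum True n + qsum False n) / 2
      - (hsum True n ^ 2 - 2 * hsum2 True False n) / 2) \<longlonglongrightarrow> 0 / 2 - 0 / 2"
    by (intro tendsto_diff tendsto_divide qsum_True_False hsum_True_shuffle tendsto_const) auto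
  ultimately show ?thesis by simp
qed

section \<open>Comparison of the coefficients in the eight identities\<close>

text \<open>Oriented so that \<open>hsum2 True False\<close> remains as the only nested sum; the
  coefficients then become polynomials in \<open>hsum\<close>, \<open>qsum\<close> and this one
  sum.\<close>

lemma hsum_stuffle:
  "hsum2 True True n = (hsum True n ^ 2 - qsum False n) / 2"
  "hsum2 False False n = (hsum False n ^ 2 - qsum False n) / 2"
  "hsum2 False True n = hsum True n * hsum False n - hsum2 True False n - qsum True n"
  using hsum_mult_hsum[of True n True] hsum_mult_hsum[of False n False] hsum_mult_hsum[of True n False]
  by (simp_all add: power2_eq_square)

lemma esign_False: "esign False n = 1"
  by (simp add: esign_def)

lemmas coeff_simps = upper_approx_def lower_conv_eq hsum_Suc hsum2_Suc qsum_Suc hsum_stuffle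
  esign_False power2_eq_square

text \<open>The suffixes in the names of these lemmas list the bars \<open>x\<close>,
  \<open>y\<close>, \<open>z\<close>. When \<open>x\<close> is \<open>False\<close>, the right side
  is grouped as the divergent sum plus a convergent rest, the shape \<open>sum_zeta_st_eq\<close>
  expects.\<close>

lemma psum_coeff_False_False_False:
  "psum u M (\<lambda>n. esign False n * (upper_approx False False M n - lower_conv False False n))
   = zeta_trunc [(1, False), (1, False), (u, False)] M
     + (zeta_trunc [(u + 1, False), (1, False)] M + zeta_trunc [(2, False), (u, False)] M)"
  unfolding zeta_trunc_eq_psum[where u = u] psum_linear
  by (rule psum_cong_parity)
    (simp_all add: coeff_simps algebra_simps add_divide_distrib diff_divide_distrib del: of_nat_Suc)

lemma psum_coeff_False_True_True:
  "psum u M (\<lambda>n. esign True n * (upper_approx False True M n - lower_conv True True n))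
   = zeta_trunc [(1, False), (1, True), (u, True)] M
     + (zeta_trunc [(1, True), (u, True), (1, True)] M
     - zeta_trunc [(1, True), (u, True), (1, False)] M
     + zeta_trunc [(u + 1, False), (1, True)] M + zeta_trunc [(2, True), (u, True)] M)"
  unfolding zeta_trunc_eq_psum[where u = u] psum_linear
  by (rule psum_cong_parity)
    (simp_all add: coeff_simps algebra_simps add_divide_distrib diff_divide_distrib del: of_nat_Suc)

lemma psum_coeff_True_True_False:
  "psum u M (\<lambda>n. esign True n * (upper_approx True True M n - lower_conv True False n))
   = zeta_trunc [(1, True), (1, True), (u, True)] M + zeta_trunc [(2, False), (u, True)] M
     + zeta_trunc [(u + 1, True), (1, True)] M"
  unfolding zeta_trunc_eq_psum[where u = u] psum_linear
  by (rule psum_cong_parity)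
    (simp_all add: coeff_simps algebra_simps add_divide_distrib diff_divide_distrib del: of_nat_Suc)

lemma psum_coeff_True_False_True:
  "psum u M (\<lambda>n. esign False n * (upper_approx True False M n - lower_conv False True n))
   = zeta_trunc [(1, True), (u, False), (1, False)] M
     + zeta_trunc [(1, True), (1, False), (u, False)] M
     - zeta_trunc [(1, True), (u, False), (1, True)] M
     + zeta_trunc [(u + 1, True), (1, False)] M + zeta_trunc [(2, True), (u, False)] M"
  unfolding zeta_trunc_eq_psum[where u = u] psum_linear
  by (rule psum_cong_parity)
    (simp_all add: coeff_simps algebra_simps add_divide_distrib diff_divide_distrib del: of_nat_Suc)

text \<open>The coefficients agree up to a multiple of the sign that is constant in
  \<open>n\<close>; the last summand records it, and its first factor is the null sequence of
  \<open>hsum2_weight_two_relation\<close>.\<close>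

lemma psum_coeff_True_False_False:
  "psum u M (\<lambda>n. esign True n * (upper_approx True False M n - lower_conv False False n))
   = zeta_trunc [(1, True), (1, True), (u, True)] M
     + 2 * zeta_trunc [(u + 1, True), (1, False)] M + zeta_trunc [(1, True), (u + 1, False)] M
     - zeta_trunc [(1, True), (u + 1, True)] M - zeta_trunc [(u + 1, True), (1, True)] M
     - zeta_trunc [(u, True), (2, False)] M - zeta_trunc [(u + 2, False)] M
     + (hsum2 True False M + qsum True M - hsum2 True True M) * zeta_trunc [(u, True)] M"
  unfolding zeta_trunc_eq_psum[where u = u] psum_linear
  by (rule psum_cong_parity)
    (simp_all add: coeff_simps algebra_simps add_divide_distrib diff_divide_distrib del: of_nat_Suc)

text \<open>The factor \<open>qsum False M\<close> survives in the limit and becomes the product of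
  two zeta values in the sixth identity.\<close>

lemma psum_coeff_False_False_True:
  "psum u M (\<lambda>n. esign True n * (upper_approx False False M n - lower_conv False True n))
   = zeta_trunc [(1, False), (1, False), (u, True)] M
     + (zeta_trunc [(u, True), (1, True), (1, True)] M
     - zeta_trunc [(u, True), (1, True), (1, False)] M
     - zeta_trunc [(u + 1, True), (1, True)] M + zeta_trunc [(u + 1, False), (1, True)] M
     + 2 * zeta_trunc [(u + 1, True), (1, True)] M - zeta_trunc [(u + 1, True), (1, False)] M
     - zeta_trunc [(u, True), (2, True)] M + qsum False M * zeta_trunc [(u, True)] M
     - zeta_trunc [(u + 2, True)] M)"
  unfolding zeta_trunc_eq_psum[where u = u] psum_linear
  by (rule psum_cong_parity)
    (simp_all add: coeff_simps algebra_simps add_divide_distrib diff_divide_distrib del: of_nat_Suc)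

text \<open>The correction in the last summand is a difference of the null sequences from
  \<open>qsum_True_False\<close> and \<open>hsum2_weight_two_relation\<close>.\<close>

lemma psum_coeff_False_True_False:
  "psum u M (\<lambda>n. esign False n * (upper_approx False True M n - lower_conv True False n))
   = zeta_trunc [(1, False), (1, True), (u, False)] M
     + (2 * zeta_trunc [(u, False), (1, True), (1, True)] M
     - 2 * zeta_trunc [(u, False), (1, True), (1, False)] M
     + zeta_trunc [(1, True), (1, False), (u, False)] M
     - zeta_trunc [(1, True), (1, True), (u, False)] M
     + zeta_trunc [(u + 1, True), (1, True)] M + zeta_trunc [(u + 1, False), (1, True)] M
     + zeta_trunc [(1, True), (u + 1, False)] M - zeta_trunc [(u + 1, True), (1, False)] M
     - zeta_trunc [(1, True), (u + 1, True)] M - zeta_trunc [(2, False), (u, False)] M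
     - 2 * zeta_trunc [(u, False), (2, True)] M - zeta_trunc [(u + 2, True)] M
     - zeta_trunc [(u + 2, False)] M + ((2 * qsum True M + qsum False M) - (hsum2 True False M
     + qsum True M - hsum2 True True M)) * zeta_trunc [(u, False)] M)"
  unfolding zeta_trunc_eq_psum[where u = u] psum_linear
  by (rule psum_cong_parity)
    (simp_all add: coeff_simps algebra_simps add_divide_distrib diff_divide_distrib del: of_nat_Suc)

lemma psum_coeff_True_True_True:
  "psum u M (\<lambda>n. esign False n * (upper_approx True True M n - lower_conv True True n))
   = 3 * zeta_trunc [(u, False), (1, True), (1, False)] M
     - 3 * zeta_trunc [(u, False), (1, True), (1, True)] M
     + zeta_trunc [(1, True), (1, True), (u, False)] M
     + 2 * zeta_trunc [(u + 1, True), (1, False)] M - zeta_trunc [(u + 1, True), (1, True)] M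
     + zeta_trunc [(u, False), (2, True)] M + zeta_trunc [(2, False), (u, False)] M
     - zeta_trunc [(u, False), (2, False)] M"
  unfolding zeta_trunc_eq_psum[where u = u] psum_linear
  by (rule psum_cong_parity)
    (simp_all add: coeff_simps algebra_simps add_divide_distrib diff_divide_distrib del: of_nat_Suc)

section \<open>Assembling the eight identities\<close>

text \<open>In the sixth and seventh identity constants stand on both sides of the regularized sum;
  this collects them.\<close>

lemma pCons_const_add_add: "[:a:] + p + [:b:] = p + [:a + b:]"
  for p :: "real poly"
  by (simp add: add.commute[of "[:a:]"] add.assoc)

theorem theorem5p7:
  fixes w :: nat
  assumes "w \<ge> 4"
  shows
  "((\<Sum>a = 1..w-2. zeta_st [(a,False),(1,False),(w-1-a,False)])
     = zeta_st [(1,False),(1,False),(w-2,False)]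
       + [: zeta [(w-1,False),(1,False)] + zeta [(2,False),(w-2,False)] :]) \<and>
  ((\<Sum>a = 1..w-2. zeta_st [(a,False),(1,True),(w-1-a,True)])
     = zeta_st [(1,False),(1,True),(w-2,True)]
       + [: zeta [(1,True),(w-2,True),(1,True)] - zeta [(1,True),(w-2,True),(1,False)]
          + zeta [(w-1,False),(1,True)] + zeta [(2,True),(w-2,True)] :]) \<and>
  ((\<Sum>a = 1..w-2. zeta [(a,True),(1,True),(w-1-a,False)])
     = zeta [(1,True),(1,True),(w-2,True)] + zeta [(2,False),(w-2,True)]
       + zeta [(w-1,True),(1,True)]) \<and>
  ((\<Sum>a = 1..w-2. zeta [(a,True),(1,False),(w-1-a,True)])
     = zeta [(1,True),(w-2,False),(1,False)] + zeta [(1,True),(1,False),(w-2,False)]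
       - zeta [(1,True),(w-2,False),(1,True)] + zeta [(w-1,True),(1,False)]
       + zeta [(2,True),(w-2,False)]) \<and>
  ((\<Sum>a = 1..w-2. zeta [(a,True),(1,False),(w-1-a,False)])
     = zeta [(1,True),(1,True),(w-2,True)] + 2 * zeta [(w-1,True),(1,False)]
       + zeta [(1,True),(w-1,False)] - zeta [(1,True),(w-1,True)]
       - zeta [(w-1,True),(1,True)] - zeta [(w-2,True),(2,False)] - zeta [(w,False)]) \<and>
  ((\<Sum>a = 1..w-2. zeta_st [(a,False),(1,False),(w-1-a,True)])
     = [: zeta [(w-2,True),(1,True),(1,True)] - zeta [(w-2,True),(1,True),(1,False)] :]
       + zeta_st [(1,False),(1,False),(w-2,True)]
       + [: - zeta [(w-1,True),(1,True)] + zeta [(w-1,False),(1,True)]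
          + 2 * zeta [(w-1,True),(1,True)] - zeta [(w-1,True),(1,False)]
          - zeta [(w-2,True),(2,True)] + zeta [(2,False)] * zeta [(w-2,True)]
          - zeta [(w,True)] :]) \<and>
  ((\<Sum>a = 1..w-2. zeta_st [(a,False),(1,True),(w-1-a,False)])
     = [: 2 * zeta [(w-2,False),(1,True),(1,True)] - 2 * zeta [(w-2,False),(1,True),(1,False)]
          + zeta [(1,True),(1,False),(w-2,False)] :]
       + zeta_st [(1,False),(1,True),(w-2,False)]
       + [: - zeta [(1,True),(1,True),(w-2,False)] + zeta [(w-1,True),(1,True)]
          + zeta [(w-1,False),(1,True)] + zeta [(1,True),(w-1,False)]
          - zeta [(w-1,True),(1,False)] - zeta [(1,True),(w-1,True)]
          - zeta [(2,False),(w-2,False)] - 2 * zeta [(w-2,False),(2,True)]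
          - zeta [(w,True)] - zeta [(w,False)] :]) \<and>
  ((\<Sum>a = 1..w-2. zeta [(a,True),(1,True),(w-1-a,True)])
     = 3 * zeta [(w-2,False),(1,True),(1,False)] - 3 * zeta [(w-2,False),(1,True),(1,True)]
       + zeta [(1,True),(1,True),(w-2,False)] + 2 * zeta [(w-1,True),(1,False)]
       - zeta [(w-1,True),(1,True)] + zeta [(w-2,False),(2,True)]
       + zeta [(2,False),(w-2,False)] - zeta [(w-2,False),(2,False)])"
proof -
  define u where "u = w - 2"
  have u: "2 \<le> u" and w: "w - 2 = u" "w - 1 = u + 1" "w = u + 2"
    using assms by (simp_all add: u_def)
  have qsum_lim: "qsum False \<longlonglongrightarrow> zeta [(2, False)]"
    unfolding qsum_def[abs_def] by (rule zeta_trunc_tendsto_zeta) auto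
  have c7: "(\<lambda>M. (2 * qsum True M + qsum False M)
      - (hsum2 True False M + qsum True M - hsum2 True True M)) \<longlonglongrightarrow> 0"
    using tendsto_diff[OF qsum_True_False hsum2_weight_two_relation] by simp
  have "(\<Sum>a=1..u. zeta_st [(a, False), (1, False), (u + 1 - a, False)])
      = zeta_st [(1, False), (1, False), (u, False)] + [: zeta [(u + 1, False), (1, False)]
        + zeta [(2, False), (u, False)] :]"
    by (rule sum_zeta_st_eq[OF u _ psum_coeff_False_False_False])
      (use u in \<open>auto intro!: tendsto_intros zeta_trunc_tendsto_zeta\<close>)
  moreover have "(\<Sum>a=1..u. zeta_st [(a, False), (1, True), (u + 1 - a, True)])
      = zeta_st [(1, False), (1, True), (u, True)]
        + [: zeta [(1, True), (u, True), (1, True)] - zeta [(1, True), (u, True), (1, False)]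
        + zeta [(u + 1, False), (1, True)] + zeta [(2, True), (u, True)] :]"
    by (rule sum_zeta_st_eq[OF u _ psum_coeff_False_True_True])
      (use u in \<open>auto intro!: tendsto_intros zeta_trunc_tendsto_zeta\<close>)
  moreover have "(\<Sum>a=1..u. zeta [(a, True), (1, True), (u + 1 - a, False)])
      = zeta [(1, True), (1, True), (u, True)] + zeta [(2, False), (u, True)]
        + zeta [(u + 1, True), (1, True)]"
    by (rule sum_zeta_eq[OF u _ _ psum_coeff_True_True_False])
      (use u in \<open>auto intro!: tendsto_intros zeta_trunc_tendsto_zeta\<close>)
  moreover have "(\<Sum>a=1..u. zeta [(a, True), (1, False), (u + 1 - a, True)])
      = zeta [(1, True), (u, False), (1, False)] + zeta [(1, True), (1, False), (u, False)]
        - zeta [(1, True), (u, False), (1, True)] + zeta [(u + 1, True), (1, False)]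
        + zeta [(2, True), (u, False)]"
    by (rule sum_zeta_eq[OF u _ _ psum_coeff_True_False_True])
      (use u in \<open>auto intro!: tendsto_intros zeta_trunc_tendsto_zeta\<close>)
  \<comment> \<open>The summand with factor 0 is the limit of the null correction, kept so that the
    limit mirrors the truncated identity term by term.\<close>
  moreover have "(\<Sum>a=1..u. zeta [(a, True), (1, False), (u + 1 - a, False)])
      = zeta [(1, True), (1, True), (u, True)] + 2 * zeta [(u + 1, True), (1, False)]
        + zeta [(1, True), (u + 1, False)] - zeta [(1, True), (u + 1, True)]
        - zeta [(u + 1, True), (1, True)] - zeta [(u, True), (2, False)]
        - zeta [(u + 2, False)] + 0 * zeta [(u, True)]"
    by (rule sum_zeta_eq[OF u _ _ psum_coeff_True_False_False], simp,
        rule tendsto_add[OF _ tendsto_mult[OF hsum2_weight_two_relation]])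
      (use u in \<open>auto intro!: tendsto_intros zeta_trunc_tendsto_zeta\<close>)
  moreover have "(\<Sum>a=1..u. zeta_st [(a, False), (1, False), (u + 1 - a, True)])
      = zeta_st [(1, False), (1, False), (u, True)]
        + [: zeta [(u, True), (1, True), (1, True)] - zeta [(u, True), (1, True), (1, False)]
        - zeta [(u + 1, True), (1, True)] + zeta [(u + 1, False), (1, True)]
        + 2 * zeta [(u + 1, True), (1, True)] - zeta [(u + 1, True), (1, False)]
        - zeta [(u, True), (2, True)] + zeta [(2, False)] * zeta [(u, True)]
        - zeta [(u + 2, True)] :]"
    by (rule sum_zeta_st_eq[OF u _ psum_coeff_False_False_True])
      (use u in \<open>auto intro!: tendsto_intros zeta_trunc_tendsto_zeta qsum_lim\<close>)
  moreover have "(\<Sum>a=1..u. zeta_st [(a, False), (1, True), (u + 1 - a, False)])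
      = zeta_st [(1, False), (1, True), (u, False)]
        + [: 2 * zeta [(u, False), (1, True), (1, True)]
        - 2 * zeta [(u, False), (1, True), (1, False)]
        + zeta [(1, True), (1, False), (u, False)] - zeta [(1, True), (1, True), (u, False)]
        + zeta [(u + 1, True), (1, True)] + zeta [(u + 1, False), (1, True)]
        + zeta [(1, True), (u + 1, False)] - zeta [(u + 1, True), (1, False)]
        - zeta [(1, True), (u + 1, True)] - zeta [(2, False), (u, False)]
        - 2 * zeta [(u, False), (2, True)] - zeta [(u + 2, True)] - zeta [(u + 2, False)]
        + 0 * zeta [(u, False)] :]"
    by (rule sum_zeta_st_eq[OF u _ psum_coeff_False_True_False],
        rule tendsto_add[OF _ tendsto_mult[OF c7]])
      (use u in \<open>auto intro!: tendsto_intros zeta_trunc_tendsto_zeta\<close>)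
  moreover have "(\<Sum>a=1..u. zeta [(a, True), (1, True), (u + 1 - a, True)])
      = 3 * zeta [(u, False), (1, True), (1, False)]
        - 3 * zeta [(u, False), (1, True), (1, True)]
        + zeta [(1, True), (1, True), (u, False)] + 2 * zeta [(u + 1, True), (1, False)]
        - zeta [(u + 1, True), (1, True)] + zeta [(u, False), (2, True)]
        + zeta [(2, False), (u, False)] - zeta [(u, False), (2, False)]"
    by (rule sum_zeta_eq[OF u _ _ psum_coeff_True_True_True])
      (use u in \<open>auto intro!: tendsto_intros zeta_trunc_tendsto_zeta\<close>)
  ultimately show ?thesis
    \<comment> \<open>The equation for \<open>w\<close> itself comes last, since it would otherwise
      rewrite the \<open>w\<close> inside \<open>w - 2\<close> and \<open>w - 1\<close>.\<close>
    unfolding w(1,2) pCons_const_add_add unfolding w(3)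
    by (simp only: mult_zero_left add_0_right) (simp add: algebra_simps)
qed

end
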